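(* Let $X$ be a quasicontinuous space. For every subset $A\subseteq X$, $\overline{A}=A^2$.
   Context: All spaces are $T_0$. Order-theoretic notions on a space $X$ refer to the specialization order: $x\le y$ iff $x\in\overline{\{y\}}$. For $A\subseteq X$, $\uparrow A=\{x: \exists a\in A,\ a\le x\}$. Directed sets are nonempty. A directed subset $D\subseteq X$ converges to $x$, $D\to x$, iff $D\cap U\neq\emptyset$ for every open $U\ni x$. Monotone determined space: a $T_0$ space $X$ such that every $U\subseteq X$ with the property "for all directed $D\subseteq X$ and all $x\in U$ with $D\to x$, $D\cap U\neq\emptyset$" is open. For finite sets $F,G\subseteq X$, $F\le G$ means $\uparrow G\subseteq\uparrow F$. A (nonempty) family $\mathcal{F}$ of finite subsets of $X$ is directed if any $F_1,F_2\in\mathcal{F}$ admit $F\in\mathcal{F}$ with $F_1\le F$, $F_2\le F$; it converges to $x$ if for each open $U\ni x$ there is $F\in\mathcal{F}$ with $F\subseteq U$. For a finite $F\subseteq X$ and $x\in X$, $F\ll_d x$ means: for every directed $D\subseteq X$ with $D\to x$, $D\cap\uparrow F\ne\emptyset$. $X$ is quasicontinuous if it is a monotone determined space and for every $x\in X$ the family $\{F\subseteq X: F\text{ finite},\ F\ll_d x\}$ is directed and converges to $x$ (it is known that quasicontinuous spaces are exactly the locally hypercompact $T_0$ spaces). For $A\subseteq X$ define $A^0=A$, $A^1=\{x\in X: \text{there is a directed } D\subseteq A^0 \text{ with } D\to x\}$, and $A^2=\{x\in X:\text{there is a directed } D\subseteq A^0\cup A^1\text{ with } D\to x\}$. $\overline{A}$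 is the closure of $A$ in $X$. *)

theory Defs
  imports "HOL-Analysis.Analysis"
begin

definition spec_le :: "'a topology \<Rightarrow> 'a \<Rightarrow> 'a \<Rightarrow> bool" where
  "spec_le X x y \<longleftrightarrow> x \<in> topspace X \<and> y \<in> topspace X \<and> x \<in> X closure_of {y}"

definition up_set :: "'a topology \<Rightarrow> 'a set \<Rightarrow> 'a set" where
  "up_set X A = {x \<in> topspace X. \<exists>a\<in>A. spec_le X a x}"

definition directed_in :: "'a topology \<Rightarrow> 'a set \<Rightarrow> bool" where
  "directed_in X D \<longleftrightarrow> D \<subseteq> topspace X \<and> D \<noteq> {} \<and>
     (\<forall>a\<in>D. \<forall>b\<in>D. \<exists>c\<in>D. spec_le X a c \<and> spec_le X b c)"

definition dir_converges :: "'a topology \<Rightarrow> 'a set \<Rightarrow> 'a \<Rightarrow> bool" where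
  "dir_converges X D x \<longleftrightarrow> x \<in> topspace X \<and> (\<forall>U. openin X U \<and> x \<in> U \<longrightarrow> D \<inter> U \<noteq> {})"

definition monotone_determined :: "'a topology \<Rightarrow> bool" where
  "monotone_determined X \<longleftrightarrow> t0_space X \<and>
     (\<forall>U. U \<subseteq> topspace X \<and>
          (\<forall>D. \<forall>x\<in>U. directed_in X D \<and> dir_converges X D x \<longrightarrow> D \<inter> U \<noteq> {})
        \<longrightarrow> openin X U)"

definition fin_le :: "'a topology \<Rightarrow> 'a set \<Rightarrow> 'a set \<Rightarrow> bool" where
  "fin_le X F G \<longleftrightarrow> up_set X G \<subseteq> up_set X F"

definition directed_family :: "'a topology \<Rightarrow> 'a set set \<Rightarrow> bool" where
  "directed_family X \<F> \<longleftrightarrow> \<F> \<noteq> {} \<and> (\<forall>F\<in>\<F>. finite F \<and> F \<subseteq> topspace X) \<and>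
     (\<forall>F1\<in>\<F>. \<forall>F2\<in>\<F>. \<exists>F\<in>\<F>. fin_le X F1 F \<and> fin_le X F2 F)"

definition family_converges :: "'a topology \<Rightarrow> 'a set set \<Rightarrow> 'a \<Rightarrow> bool" where
  "family_converges X \<F> x \<longleftrightarrow> x \<in> topspace X \<and>
     (\<forall>U. openin X U \<and> x \<in> U \<longrightarrow> (\<exists>F\<in>\<F>. F \<subseteq> U))"

definition way_below_d :: "'a topology \<Rightarrow> 'a set \<Rightarrow> 'a \<Rightarrow> bool" where
  "way_below_d X F x \<longleftrightarrow>
     (\<forall>D. directed_in X D \<and> dir_converges X D x \<longrightarrow> D \<inter> up_set X F \<noteq> {})"

definition quasicontinuous :: "'a topology \<Rightarrow> bool" where
  "quasicontinuous X \<longleftrightarrow> monotone_determined X \<and>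
     (\<forall>x\<in>topspace X.
        directed_family X {F. F \<subseteq> topspace X \<and> finite F \<and> way_below_d X F x} \<and>
        family_converges X {F. F \<subseteq> topspace X \<and> finite F \<and> way_below_d X F x} x)"

definition dir_limits :: "'a topology \<Rightarrow> 'a set \<Rightarrow> 'a set" where
  "dir_limits X B = {x \<in> topspace X. \<exists>D. directed_in X D \<and> D \<subseteq> B \<and> dir_converges X D x}"

text \<open>The sets \<open>A\<^sup>1\<close> and \<open>A\<^sup>2\<close>, where \<open>A\<^sup>0 = A\<close>.\<close>

definition first_limits :: "'a topology \<Rightarrow> 'a set \<Rightarrow> 'a set" where
  "first_limits X A = dir_limits X A"

definition second_limits :: "'a topology \<Rightarrow> 'a set \<Rightarrow> 'a set" where
  "second_limits X A = dir_limits X (A \<union> first_limits X A)"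

end

theory Submission
  imports Defs
begin

text \<open>
  The proof rests on Rudin's lemma: a family of finite sets that is directed for the order
  \<open>F \<le> G\<close> and has no member inside a given upper set \<open>K\<close> is met by a directed set avoiding
  \<open>K\<close>. With \<open>K = up_set X F\<close> it shows that \<open>{y. F \<lless>\<^sub>d y}\<close> is open. Hence, if \<open>x\<close> lies in the
  closure of \<open>A\<close>, every \<open>F \<lless>\<^sub>d x\<close> meets the lower closure of \<open>A\<close>, and Rudin's lemma, with \<open>K\<close> the
  complement of that lower closure, yields a directed set below \<open>A\<close> converging to \<open>x\<close>. Finally,
  \<open>d \<le> a\<close> means that the constant net \<open>{a}\<close> converges to \<open>d\<close>, so the lower closure of \<open>A\<close> is
  contained in \<open>A\<^sup>1\<close>.
\<close>

lemma spec_le_iff: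
  "spec_le X x y \<longleftrightarrow> x \<in> topspace X \<and> y \<in> topspace X \<and> (\<forall>U. openin X U \<and> x \<in> U \<longrightarrow> y \<in> U)"
  by (auto simp: spec_le_def in_closure_of)

lemma spec_le_refl: "x \<in> topspace X \<Longrightarrow> spec_le X x x"
  by (simp add: spec_le_iff)

lemma spec_le_trans: "spec_le X x y \<Longrightarrow> spec_le X y z \<Longrightarrow> spec_le X x z"
  by (auto simp: spec_le_iff)

lemma subset_up_set: "F \<subseteq> topspace X \<Longrightarrow> F \<subseteq> up_set X F"
  using spec_le_refl by (fastforce simp: up_set_def)

lemma up_set_upward: "x \<in> up_set X F \<Longrightarrow> spec_le X x y \<Longrightarrow> y \<in> up_set X F"
  by (auto simp: up_set_def intro: spec_le_trans) (simp add: spec_le_iff)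

lemma fin_leD:
  assumes "fin_le X F G" "G \<subseteq> topspace X" "g \<in> G"
  obtains f where "f \<in> F" "spec_le X f g"
  using assms subset_up_set[of G X] by (auto simp: fin_le_def up_set_def)

lemma directed_singleton: "a \<in> topspace X \<Longrightarrow> directed_in X {a}"
  by (simp add: directed_in_def spec_le_refl)

lemma singleton_converges_iff: "a \<in> topspace X \<Longrightarrow> dir_converges X {a} x \<longleftrightarrow> spec_le X x a"
  by (auto simp: dir_converges_def spec_le_iff)

lemma dir_converges_mono: "dir_converges X D y \<Longrightarrow> spec_le X x y \<Longrightarrow> dir_converges X D x"
  by (auto simp: dir_converges_def spec_le_iff)

text \<open>Zorn's lemma enlarges \<open>K\<close> to a maximal upper set \<open>M\<close> that
  still contains no member of the family; the wanted \<open>D\<close> is the complement of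
  \<open>M\<close>. It meets every member by the choice of \<open>M\<close>, and maximality makes it
  directed.\<close>

lemma Rudin:
  assumes fam: "directed_family X \<F>"
    and up: "\<And>x y. x \<in> K \<Longrightarrow> spec_le X x y \<Longrightarrow> y \<in> K"
    and avoid: "\<And>F. F \<in> \<F> \<Longrightarrow> \<not> F \<subseteq> K"
  obtains D where "directed_in X D" "D \<inter> K = {}" "\<And>F. F \<in> \<F> \<Longrightarrow> D \<inter> F \<noteq> {}"
proof -
  define P where "P = {U. K \<subseteq> U \<and> (\<forall>x y. x \<in> U \<longrightarrow> spec_le X x y \<longrightarrow> y \<in> U) \<and> (\<forall>F\<in>\<F>. \<not> F \<subseteq> U)}"
  have fin: "finite F" "F \<subseteq> topspace X" if "F \<in> \<F>" for F
    using fam that by (auto simp: directed_family_def)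
  have "K \<in> P"
    using up avoid by (auto simp: P_def)
  moreover have "\<Union>\<C> \<in> P" if "\<C> \<noteq> {}" "subset.chain P \<C>" for \<C>
  proof -
    have C: "\<C> \<subseteq> P"
      using that by (simp add: subset.chain_def)
    \<comment> \<open>Finiteness of the members matters here: a finite set covered by a chain lies
      in a single element of that chain.\<close>
    have "\<not> F \<subseteq> \<Union>\<C>" if "F \<in> \<F>" for F
    proof
      assume "F \<subseteq> \<Union>\<C>"
      then obtain U where "U \<in> \<C>" "F \<subseteq> U"
        using finite_subset_Union_chain[of F \<C> P] fin[OF \<open>F \<in> \<F>\<close>] \<open>\<C> \<noteq> {}\<close> \<open>subset.chain P \<C>\<close>
        by blast
      then show False
        using C \<open>F \<in> \<F>\<close> by (auto simp: P_def)
    qed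
    moreover have "K \<subseteq> \<Union>\<C>"
      using C \<open>\<C> \<noteq> {}\<close> unfolding P_def by blast
    moreover have "y \<in> \<Union>\<C>" if "x \<in> \<Union>\<C>" "spec_le X x y" for x y
      using C that unfolding P_def by blast
    ultimately show ?thesis
      unfolding P_def by blast
  qed
  ultimately obtain M where "M \<in> P" and max: "\<And>U. U \<in> P \<Longrightarrow> M \<subseteq> U \<Longrightarrow> U = M"
    using subset_Zorn_nonempty[of P] by blast
  then have KM: "K \<subseteq> M" and Mup: "\<And>x y. x \<in> M \<Longrightarrow> spec_le X x y \<Longrightarrow> y \<in> M"
    and Mavoid: "\<And>F. F \<in> \<F> \<Longrightarrow> \<not> F \<subseteq> M"
    by (auto simp: P_def)
  define D where "D = topspace X - M"
  have meet: "D \<inter> F \<noteq> {}" if "F \<in> \<F>" for F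
    using Mavoid[OF that] fin[OF that] by (auto simp: D_def)
  \<comment> \<open>Adjoining \<open>up_set X {a}\<close> to \<open>M\<close> gives a strictly
    larger upper set, so by maximality it swallows some member \<open>F\<close>; what
    \<open>F\<close> has outside \<open>M\<close> must then lie above \<open>a\<close>.\<close>
  have above: "\<exists>F\<in>\<F>. \<forall>f\<in>F \<inter> D. spec_le X a f" if "a \<in> D" for a
  proof -
    have a: "a \<in> topspace X" "a \<notin> M"
      using that by (auto simp: D_def)
    have "M \<union> up_set X {a} \<notin> P"
      using max[of "M \<union> up_set X {a}"] subset_up_set[of "{a}" X] a by blast
    moreover have "y \<in> M \<union> up_set X {a}" if "x \<in> M \<union> up_set X {a}" "spec_le X x y" for x y
      using that Mup[of x y] up_set_upward[of x X "{a}" y] by blast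
    ultimately obtain F where "F \<in> \<F>" "F \<subseteq> M \<union> up_set X {a}"
      using KM unfolding P_def by blast
    then show ?thesis
      by (auto simp: D_def up_set_def)
  qed
  have "\<exists>c\<in>D. spec_le X a c \<and> spec_le X b c" if "a \<in> D" "b \<in> D" for a b
  proof -
    obtain F G where F: "F \<in> \<F>" "\<forall>f\<in>F \<inter> D. spec_le X a f"
      and G: "G \<in> \<F>" "\<forall>g\<in>G \<inter> D. spec_le X b g"
      using above \<open>a \<in> D\<close> \<open>b \<in> D\<close> by meson
    then obtain H where H: "H \<in> \<F>" "fin_le X F H" "fin_le X G H"
      using fam unfolding directed_family_def by meson
    obtain c where c: "c \<in> D" "c \<in> H"
      using meet[OF H(1)] by blast
    obtain f g where fg: "f \<in> F" "spec_le X f c" "g \<in> G" "spec_le X g c"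
      using H c fin fin_leD by metis
    \<comment> \<open>The complement of an upper set is closed downwards, so the points of
      \<open>F\<close> and \<open>G\<close> below \<open>c\<close> stay in \<open>D\<close> and
      hence lie above \<open>a\<close> and \<open>b\<close>.\<close>
    have "f \<in> D" if "spec_le X f c" for f
      using that c Mup[of f c] by (auto simp: D_def spec_le_def)
    then have "f \<in> D" "g \<in> D"
      using fg by blast+
    then show ?thesis
      using F G fg c(1) spec_le_trans[of X a f c] spec_le_trans[of X b g c] by blast
  qed
  moreover have "D \<noteq> {}"
    using fam meet by (auto simp: directed_family_def)
  ultimately have "directed_in X D"
    by (auto simp: directed_in_def D_def)
  moreover have "D \<inter> K = {}"
    using KM by (auto simp: D_def)
  ultimately show ?thesis
    using that meet by blast
qed

lemma dir_converges_if_meets: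
  assumes "family_converges X \<F> x" "\<And>F. F \<in> \<F> \<Longrightarrow> D \<inter> F \<noteq> {}"
  shows "dir_converges X D x"
  unfolding dir_converges_def
proof (intro conjI allI impI)
  show "x \<in> topspace X"
    using assms(1) by (simp add: family_converges_def)
  fix U assume "openin X U \<and> x \<in> U"
  then obtain F where "F \<in> \<F>" "F \<subseteq> U"
    using assms(1) unfolding family_converges_def by blast
  then show "D \<inter> U \<noteq> {}"
    using assms(2)[of F] by blast
qed

text \<open>Every directed set converging to \<open>y\<close> also converges to the smaller point
  \<open>x\<close>, which has fewer open neighbourhoods.\<close>

lemma way_below_d_mono: "way_below_d X F x \<Longrightarrow> spec_le X x y \<Longrightarrow> way_below_d X F y"
  by (auto simp: way_below_d_def dest: dir_converges_mono)

text \<open>Test the definition on the directed set \<open>{x}\<close>, which converges to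
  \<open>x\<close>.\<close>

lemma way_below_d_up_set: "way_below_d X F x \<Longrightarrow> x \<in> topspace X \<Longrightarrow> x \<in> up_set X F"
  using directed_singleton[of x X] singleton_converges_iff[of x X x] spec_le_refl[of x X]
  by (auto simp: way_below_d_def)

lemma way_below_d_fin_le:
  assumes "way_below_d X G x" "G \<subseteq> up_set X F"
  shows "way_below_d X F x"
proof -
  have "up_set X G \<subseteq> up_set X F"
    using assms(2) up_set_upward[of _ X F] unfolding up_set_def[of X G] by blast
  then show ?thesis
    using assms(1) unfolding way_below_d_def by blast
qed

lemma monotone_determined_openinI:
  assumes "monotone_determined X" "U \<subseteq> topspace X"
    and "\<And>D x. x \<in> U \<Longrightarrow> directed_in X D \<Longrightarrow> dir_converges X D x \<Longrightarrow> D \<inter> U \<noteq> {}"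
  shows "openin X U"
proof -
  have "\<forall>D. \<forall>x\<in>U. directed_in X D \<and> dir_converges X D x \<longrightarrow> D \<inter> U \<noteq> {}"
    using assms(3) by simp
  with assms(1,2) show ?thesis
    by (simp add: monotone_determined_def)
qed

text \<open>Openness is tested on a directed set \<open>E\<close> converging to \<open>y\<close>. If
  \<open>E\<close> missed the set, the finite sets way below points of \<open>E\<close> would form a
  directed family converging to \<open>y\<close> with no member inside \<open>up_set X F\<close>.
  Rudin's lemma would then give a directed set converging to \<open>y\<close> and avoiding
  \<open>up_set X F\<close>, against the choice of \<open>y\<close>.\<close>

lemma openin_way_below_d:
  assumes X: "quasicontinuous X"
  shows "openin X {y \<in> topspace X. way_below_d X F y}" (is "openin X ?W")
proof -
  let ?B = "\<lambda>x. {G. G \<subseteq> topspace X \<and> finite G \<and> way_below_d X G x}"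
  have dirB: "directed_family X (?B x)" and convB: "family_converges X (?B x) x"
    if "x \<in> topspace X" for x
    using X that by (auto simp: quasicontinuous_def)
  have "E \<inter> ?W \<noteq> {}" if y: "y \<in> ?W" and E: "directed_in X E" "dir_converges X E y" for E y
  proof
    assume empty: "E \<inter> ?W = {}"
    have Etop: "E \<subseteq> topspace X"
      using E by (simp add: directed_in_def)
    define \<G> where "\<G> = (\<Union>e\<in>E. ?B e)"
    have "\<exists>G\<in>\<G>. fin_le X G1 G \<and> fin_le X G2 G" if G12: "G1 \<in> \<G>" "G2 \<in> \<G>" for G1 G2
    proof -
      obtain e1 e2 where "e1 \<in> E" "e2 \<in> E" "G1 \<in> ?B e1" "G2 \<in> ?B e2"
        using G12 by (auto simp: \<G>_def)
      moreover then obtain e where e: "e \<in> E" "spec_le X e1 e" "spec_le X e2 e"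
        using E unfolding directed_in_def by meson
      \<comment> \<open>Passing to an upper bound \<open>e\<close> in \<open>E\<close> places both
        sets in one family \<open>?B e\<close>, whose directedness is part of
        quasicontinuity.\<close>
      ultimately have "G1 \<in> ?B e" "G2 \<in> ?B e"
        using way_below_d_mono[of X G1 e1 e] way_below_d_mono[of X G2 e2 e] e by simp_all
      moreover have "directed_family X (?B e)"
        using dirB e Etop by blast
      ultimately obtain G where "G \<in> ?B e" "fin_le X G1 G" "fin_le X G2 G"
        unfolding directed_family_def by meson
      then show ?thesis
        using e by (auto simp: \<G>_def)
    qed
    moreover obtain e where "e \<in> E"
      using E(1) unfolding directed_in_def by blast
    then have "?B e \<noteq> {}"
      using dirB[of e] Etop unfolding directed_family_def by (meson subsetD)
    then have "\<G> \<noteq> {}"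
      using \<open>e \<in> E\<close> by (auto simp: \<G>_def)
    moreover have "finite G \<and> G \<subseteq> topspace X" if "G \<in> \<G>" for G
      using that by (auto simp: \<G>_def)
    ultimately have dirG: "directed_family X \<G>"
      unfolding directed_family_def by blast
    have avoid: "\<not> G \<subseteq> up_set X F" if G: "G \<in> \<G>" for G
    proof
      assume "G \<subseteq> up_set X F"
      moreover obtain e where "e \<in> E" "way_below_d X G e"
        using G by (auto simp: \<G>_def)
      ultimately have "e \<in> E \<inter> ?W"
        using Etop way_below_d_fin_le[of X G e F] by blast
      then show False
        using empty by blast
    qed
    obtain D where D: "directed_in X D" "D \<inter> up_set X F = {}" "\<And>G. G \<in> \<G> \<Longrightarrow> D \<inter> G \<noteq> {}"
      by (rule Rudin[OF dirG, of "up_set X F"]) (use up_set_upward avoid in \<open>assumption | fast\<close>)+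
    \<comment> \<open>Two approximations are composed: \<open>E\<close> enters \<open>U\<close> at
      some \<open>e\<close>, and some finite set way below \<open>e\<close> lies inside
      \<open>U\<close>.\<close>
    have "family_converges X \<G> y"
      unfolding family_converges_def
    proof (intro conjI allI impI)
      show "y \<in> topspace X"
        using y by simp
      fix U assume "openin X U \<and> y \<in> U"
      moreover then have "E \<inter> U \<noteq> {}"
        using E(2) by (simp add: dir_converges_def)
      ultimately obtain e where "e \<in> E" "e \<in> U" "openin X U"
        by blast
      moreover then obtain G where "G \<in> ?B e" "G \<subseteq> U"
        using convB[of e] Etop unfolding family_converges_def by (meson subsetD)
      ultimately show "\<exists>G\<in>\<G>. G \<subseteq> U"
        by (auto simp: \<G>_def)
    qed
    then have "dir_converges X D y"
      using D(3) by (rule dir_converges_if_meets)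
    then show False
      using y D(1,2) unfolding way_below_d_def by blast
  qed
  moreover have "monotone_determined X"
    using X by (simp add: quasicontinuous_def)
  ultimately show ?thesis
    by (intro monotone_determined_openinI) auto
qed

lemma closure_of_meets_open:
  assumes "x \<in> X closure_of A" "openin X U" "x \<in> U"
  obtains a where "a \<in> A" "a \<in> U"
  using assms by (auto simp: in_closure_of)

text \<open>Closures absorb directed limits; applying this once to \<open>A\<close> and once to
  \<open>A\<close> with its first limits gives the easy inclusion of the theorem.\<close>

lemma dir_limits_subset_closure_of:
  assumes "B \<subseteq> X closure_of A"
  shows "dir_limits X B \<subseteq> X closure_of A"
proof
  fix x assume "x \<in> dir_limits X B"
  then obtain D where x: "x \<in> topspace X" and D: "D \<subseteq> B" "dir_converges X D x"
    by (auto simp: dir_limits_def)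
  have "\<exists>a\<in>A. a \<in> U" if "openin X U" "x \<in> U" for U
  proof -
    have "D \<inter> U \<noteq> {}"
      using D(2) that by (simp add: dir_converges_def)
    then obtain d where "d \<in> D" "d \<in> U"
      by blast
    then have "d \<in> X closure_of A"
      using D(1) assms by blast
    then show ?thesis
      using \<open>d \<in> U\<close> that(1) closure_of_meets_open by metis
  qed
  then show "x \<in> X closure_of A"
    using x by (auto simp: in_closure_of)
qed

theorem theorem5p4:
  fixes X :: "'a topology" and A :: "'a set"
  assumes "quasicontinuous X"
    and "A \<subseteq> topspace X"
  shows "X closure_of A = second_limits X A"
proof
  show "second_limits X A \<subseteq> X closure_of A"
    using closure_of_subset[OF assms(2)] unfolding second_limits_def first_limits_def
    by (intro dir_limits_subset_closure_of Un_least)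
next
  show "X closure_of A \<subseteq> second_limits X A"
  proof
    fix x assume x: "x \<in> X closure_of A"
    then have xtop: "x \<in> topspace X"
      by (simp add: in_closure_of)
    define \<F> where "\<F> = {F. F \<subseteq> topspace X \<and> finite F \<and> way_below_d X F x}"
    have fam: "directed_family X \<F>" "family_converges X \<F> x"
      using assms(1) xtop by (auto simp: quasicontinuous_def \<F>_def)
    \<comment> \<open>Points outside the carrier also belong to \<open>K\<close>, since
      \<open>spec_le\<close> fails for them; Rudin's lemma only asks that \<open>K\<close> be closed
      upwards.\<close>
    define K where "K = {d. \<forall>a\<in>A. \<not> spec_le X d a}"
    \<comment> \<open>The open set of points that \<open>F\<close> is way below contains
      \<open>x\<close>, hence some \<open>a\<close> in \<open>A\<close>; a point of \<open>F\<close>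
      below \<open>a\<close> is not in \<open>K\<close>.\<close>
    have avoid: "\<not> F \<subseteq> K" if "F \<in> \<F>" for F
    proof -
      have "x \<in> {y \<in> topspace X. way_below_d X F y}"
        using that xtop by (simp add: \<F>_def)
      then obtain a where "a \<in> A" "a \<in> topspace X" "way_below_d X F a"
        using closure_of_meets_open[OF x openin_way_below_d[OF assms(1)]] by blast
      then show ?thesis
        using way_below_d_up_set[of X F a] by (auto simp: K_def up_set_def)
    qed
    have Kup: "e \<in> K" if "d \<in> K" "spec_le X d e" for d e
      using that spec_le_trans[of X d e] by (auto simp: K_def)
    obtain D where D: "directed_in X D" "D \<inter> K = {}" "\<And>F. F \<in> \<F> \<Longrightarrow> D \<inter> F \<noteq> {}"
      by (rule Rudin[OF fam(1), of K]) (use Kup avoid in \<open>assumption | fast\<close>)+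
    have "D \<subseteq> first_limits X A"
    proof
      fix d assume "d \<in> D"
      then obtain a where "a \<in> A" "spec_le X d a"
        using D by (auto simp: K_def)
      then have "d \<in> topspace X" "directed_in X {a}" "{a} \<subseteq> A" "dir_converges X {a} d"
        by (simp_all add: spec_le_def directed_singleton singleton_converges_iff)
      then show "d \<in> first_limits X A"
        unfolding first_limits_def dir_limits_def by blast
    qed
    moreover have "dir_converges X D x"
      using fam(2) D(3) by (rule dir_converges_if_meets)
    ultimately show "x \<in> second_limits X A"
      using D(1) xtop unfolding second_limits_def dir_limits_def by blast
  qed
qed

end
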